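(* Let $h\geq 2$ be an integer, let $m_0=2h(2h-1)$, $m_1=(2h+1)(2h-1)$, $m_2=2h(2h+1)$, $m_3=2h(2h+1)+(2h-1)$, let $\Gamma_h=\langle m_0,m_1,m_2,m_3\rangle$ be the numerical semigroup they generate, let $K$ be a field and let $R=K[[t^{m_0},t^{m_1},t^{m_2},t^{m_3}]]$ with maximal ideal $\mathfrak{m}$. Let $HG_{\mathfrak{m}}(\Gamma_h)(x)$ be the Hilbert series of the tangent cone $G_{\mathfrak{m}}(\Gamma_h)$. Then $$HG_{\mathfrak{m}}(\Gamma_h)(x)=\frac{\sum_{k=1}^{2h-2}(2k+1)x^k+(2h-1)x^{2h-1}}{1-x}.$$
   Context: The tangent cone is the associated graded ring $G_{\mathfrak{m}}(\Gamma_h)=\bigoplus_{n\geq 0}\mathfrak{m}^n/\mathfrak{m}^{n+1}$ of $R$, and its Hilbert series is $\sum_{n\geq 0}\dim_K(\mathfrak{m}^n/\mathfrak{m}^{n+1})\,x^n$.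
   Formalization: The sum in the numerator is taken from k=0 instead of k=1: the constant term of the Hilbert series is dim_K(R/m)=1, while the formula as printed has constant term 0, so it is false for every h. *)

theory Defs
  imports
    "HOL-Algebra.Algebra"
    "HOL-Algebra.Algebraic_Closure_Type"
    "HOL-Computational_Algebra.Formal_Power_Series"
begin

inductive_set numerical_semigroup :: "nat set \<Rightarrow> nat set" for A where
  zero: "0 \<in> numerical_semigroup A"
| add: "n \<in> numerical_semigroup A \<Longrightarrow> a \<in> A \<Longrightarrow> n + a \<in> numerical_semigroup A"

definition exponents_of_weight :: "nat list \<Rightarrow> nat \<Rightarrow> nat list set" where
  "exponents_of_weight ms n =
     {\<alpha>. length \<alpha> = length ms \<and> (\<Sum>i<length ms. \<alpha> ! i * ms ! i) = n}"

text \<open>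
  \<open>K[[t^m1, ..., t^mr]]\<close> inside \<open>K[[t]]\<close>, as the image of \<open>K[[x1, ..., xr]]\<close> under
  \<open>xi \<mapsto> t^mi\<close>: the series with coefficients \<open>c \<alpha>\<close> (indexed by exponent vectors \<open>\<alpha>\<close>) is
  sent to the series whose \<open>n\<close>-th coefficient collects all \<open>\<alpha>\<close> of weight \<open>n\<close>.
  All \<open>mi\<close> must be positive: otherwise the sums below may be infinite, and hence are \<open>0\<close>.
\<close>
definition monomial_power_series :: "nat list \<Rightarrow> 'k::field fps set" where
  "monomial_power_series ms =
     range (\<lambda>c :: nat list \<Rightarrow> 'k. Abs_fps (\<lambda>n. \<Sum>\<alpha>\<in>exponents_of_weight ms n. c \<alpha>))"

definition monomial_power_series_ring :: "nat list \<Rightarrow> 'k::field fps ring" where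
  "monomial_power_series_ring ms =
     ring_of_type_algebra\<lparr>carrier := monomial_power_series ms\<rparr>"

text \<open>
  The homogeneous component \<open>I^n / I^(n+1)\<close> of the associated graded ring of \<open>I\<close>, realised as a
  set of cosets, i.e. as a subset of the quotient ring \<open>R / I^(n+1)\<close>.
\<close>
definition graded_component ::
    "('a, 'b) ring_scheme \<Rightarrow> 'a set \<Rightarrow> nat \<Rightarrow> 'a set set" where
  "graded_component R I n =
     (\<lambda>f. (I [^]\<^bsub>ideals_set R\<^esub> Suc n) +>\<^bsub>R\<^esub> f) ` (I [^]\<^bsub>ideals_set R\<^esub> n)"

text \<open>
  A subfield \<open>K\<close> of \<open>R\<close> acts on \<open>I^n / I^(n+1)\<close> through its image in \<open>R / I^(n+1)\<close>. The ring
  multiplication of the associated graded ring does not enter its Hilbert function.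
\<close>
definition graded_hilbert_function ::
    "('a, 'b) ring_scheme \<Rightarrow> 'a set \<Rightarrow> 'a set \<Rightarrow> nat \<Rightarrow> nat" where
  "graded_hilbert_function R K I n =
     ring.dim (R Quot (I [^]\<^bsub>ideals_set R\<^esub> Suc n))
       ((\<lambda>c. (I [^]\<^bsub>ideals_set R\<^esub> Suc n) +>\<^bsub>R\<^esub> c) ` K) (graded_component R I n)"

definition graded_hilbert_series ::
    "('a, 'b) ring_scheme \<Rightarrow> 'a set \<Rightarrow> 'a set \<Rightarrow> rat fps" where
  "graded_hilbert_series R K I = Abs_fps (\<lambda>n. of_nat (graded_hilbert_function R K I n))"

lemma finite_exponents_of_weight:
  assumes "\<forall>m\<in>set ms. 0 < m"
  shows "finite (exponents_of_weight ms n)"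
proof (rule finite_subset)
  show "exponents_of_weight ms n \<subseteq> {\<alpha>. set \<alpha> \<subseteq> {..n} \<and> length \<alpha> = length ms}"
  proof
    fix \<alpha> assume a: "\<alpha> \<in> exponents_of_weight ms n"
    have "\<alpha> ! i \<le> n" if "i < length ms" for i
    proof -
      have "\<alpha> ! i \<le> \<alpha> ! i * ms ! i" using assms that by (simp add: Suc_leI)
      also have "\<dots> \<le> (\<Sum>i<length ms. \<alpha> ! i * ms ! i)"
        using that by (intro member_le_sum) auto
      finally show ?thesis using a by (simp add: exponents_of_weight_def)
    qed
    then show "\<alpha> \<in> {\<alpha>. set \<alpha> \<subseteq> {..n} \<and> length \<alpha> = length ms}"
      using a by (auto simp: exponents_of_weight_def in_set_conv_nth)
  qed
qed (simp add: finite_lists_length_eq)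

lemma numerical_semigroup_add_mult:
  assumes "n \<in> numerical_semigroup A" "a \<in> A"
  shows "n + k * a \<in> numerical_semigroup A"
proof (induction k)
  case (Suc k)
  then show ?case using numerical_semigroup.add[OF Suc assms(2)] by (simp add: algebra_simps)
qed (use assms in simp)

lemma numerical_semigroup_iff:
  "n \<in> numerical_semigroup (set ms) \<longleftrightarrow> exponents_of_weight ms n \<noteq> {}"
proof
  assume "n \<in> numerical_semigroup (set ms)"
  then show "exponents_of_weight ms n \<noteq> {}"
  proof induction
    case zero
    have "replicate (length ms) 0 \<in> exponents_of_weight ms 0"
      by (simp add: exponents_of_weight_def)
    then show ?case by blast
  next
    case (add n a)
    then obtain \<alpha> j where \<alpha>: "\<alpha> \<in> exponents_of_weight ms n" and j: "j < length ms" "a = ms ! j"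
      by (auto simp: in_set_conv_nth)
    have "(\<Sum>i<length ms. \<alpha>[j := Suc (\<alpha> ! j)] ! i * ms ! i) =
        (\<Sum>i<length ms. \<alpha> ! i * ms ! i + (if i = j then ms ! j else 0))"
      using \<alpha> by (intro sum.cong) (auto simp: exponents_of_weight_def nth_list_update)
    also have "\<dots> = n + a"
      using \<alpha> j by (simp add: sum.distrib exponents_of_weight_def)
    finally have "\<alpha>[j := Suc (\<alpha> ! j)] \<in> exponents_of_weight ms (n + a)"
      using \<alpha> by (simp add: exponents_of_weight_def)
    then show ?case by blast
  qed
next
  assume "exponents_of_weight ms n \<noteq> {}"
  then obtain \<alpha> where \<alpha>: "(\<Sum>i<length ms. \<alpha> ! i * ms ! i) = n"
    by (auto simp: exponents_of_weight_def)
  have "(\<Sum>i<k. \<alpha> ! i * ms ! i) \<in> numerical_semigroup (set ms)" if "k \<le> length ms" for k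
    using that
    by (induction k) (auto intro: numerical_semigroup.zero numerical_semigroup_add_mult)
  with \<alpha> show "n \<in> numerical_semigroup (set ms)" by blast
qed

text \<open>
  Thus \<open>K[[t^m1, ..., t^mr]]\<close> is the ring \<open>K[[\<Gamma>]]\<close> of power series with exponents in the
  semigroup \<open>\<Gamma>\<close> generated by \<open>m1, ..., mr\<close>.
\<close>
theorem monomial_power_series_eq:
  assumes "\<forall>m\<in>set ms. 0 < m"
  shows "monomial_power_series ms =
    {f :: 'k::field fps. \<forall>n. fps_nth f n \<noteq> 0 \<longrightarrow> n \<in> numerical_semigroup (set ms)}"
proof (intro equalityI subsetI)
  fix f :: "'k fps" assume "f \<in> monomial_power_series ms"
  then show "f \<in> {f. \<forall>n. fps_nth f n \<noteq> 0 \<longrightarrow> n \<in> numerical_semigroup (set ms)}"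
    by (auto simp: monomial_power_series_def numerical_semigroup_iff)
next
  fix f :: "'k fps"
  assume f: "f \<in> {f. \<forall>n. fps_nth f n \<noteq> 0 \<longrightarrow> n \<in> numerical_semigroup (set ms)}"
  define r where "r n = (SOME \<alpha>. \<alpha> \<in> exponents_of_weight ms n)" for n
  define c where "c \<alpha> = (let n = (\<Sum>i<length ms. \<alpha> ! i * ms ! i)
      in if \<alpha> = r n then fps_nth f n else 0)" for \<alpha>
  have "(\<Sum>\<alpha>\<in>exponents_of_weight ms n. c \<alpha>) = fps_nth f n" for n
  proof (cases "exponents_of_weight ms n = {}")
    case True
    then show ?thesis using f numerical_semigroup_iff by auto
  next
    case False
    then have r: "r n \<in> exponents_of_weight ms n"
      unfolding r_def by (simp add: some_in_eq)
    have "(\<Sum>\<alpha>\<in>exponents_of_weight ms n. c \<alpha>) =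
        (\<Sum>\<alpha>\<in>exponents_of_weight ms n. if \<alpha> = r n then fps_nth f n else 0)"
      by (intro sum.cong) (auto simp: c_def exponents_of_weight_def)
    also have "\<dots> = fps_nth f n"
      using r finite_exponents_of_weight[OF assms] by simp
    finally show ?thesis .
  qed
  then have "f = Abs_fps (\<lambda>n. \<Sum>\<alpha>\<in>exponents_of_weight ms n. c \<alpha>)"
    by (simp add: fps_eq_iff)
  then show "f \<in> monomial_power_series ms"
    unfolding monomial_power_series_def by blast
qed

lemma numerical_semigroup_plus:
  assumes "n \<in> numerical_semigroup A" "k \<in> numerical_semigroup A"
  shows "n + k \<in> numerical_semigroup A"
  using assms(2)
proof induction
  case (add k a)
  then show ?case using numerical_semigroup.add[of "n + k" A a] by (simp add: add.assoc)
qed (use assms in simp)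

lemma cring_monomial_power_series_ring:
  assumes "\<forall>m\<in>set ms. 0 < m"
  shows "cring (monomial_power_series_ring ms :: 'k::field fps ring)"
proof -
  let ?S = "ring_of_type_algebra :: 'k fps ring"
  let ?G = "numerical_semigroup (set ms)"
  interpret S: cring ?S
    by (rule cring_from_type_algebra)
  define R :: "'k fps set" where "R = monomial_power_series ms"
  have R: "f \<in> R \<longleftrightarrow> (\<forall>n. n \<notin> ?G \<longrightarrow> fps_nth f n = 0)" for f
    unfolding R_def monomial_power_series_eq[OF assms] by blast
  have uminus: "\<ominus>\<^bsub>?S\<^esub> f = - f" for f
    by (rule S.minus_equality) (simp_all add: ring_of_type_algebra_def)
  have times: "f * g \<in> R" if fg: "f \<in> R" "g \<in> R" for f g
    unfolding R
  proof (intro allI impI)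
    fix n assume n: "n \<notin> ?G"
    show "fps_nth (f * g) n = 0"
      unfolding fps_mult_nth
    proof (intro sum.neutral ballI)
      fix i assume "i \<in> {0..n}"
      then have "i \<notin> ?G \<or> n - i \<notin> ?G"
        using n numerical_semigroup_plus[of i "set ms" "n - i"] by auto
      then show "fps_nth f i * fps_nth g (n - i) = 0"
        using fg unfolding R by auto
    qed
  qed
  have sub: "R \<subseteq> carrier ?S"
    by (simp add: ring_of_type_algebra_def)
  have "subring R ?S"
  proof (rule S.subringI[OF sub])
    show "\<one>\<^bsub>?S\<^esub> \<in> R"
      using numerical_semigroup.zero[of "set ms"]
      by (metis R fps_one_nth ring.simps(2) ring_of_type_algebra_def monoid.simps(2))
    show "\<ominus>\<^bsub>?S\<^esub> f \<in> R" if "f \<in> R" for f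
      using that by (simp add: uminus R)
    show "f \<otimes>\<^bsub>?S\<^esub> g \<in> R" if "f \<in> R" "g \<in> R" for f g
      using times[OF that] by (simp add: ring_of_type_algebra_def)
    show "f \<oplus>\<^bsub>?S\<^esub> g \<in> R" if "f \<in> R" "g \<in> R" for f g
      using that by (simp add: ring_of_type_algebra_def R)
  qed
  then have "subcring R ?S"
    by (rule S.subcringI')
  then show ?thesis
    unfolding monomial_power_series_ring_def R_def[symmetric]
    using S.subcring_iff[OF sub] by blast
qed

end

theory Submission
  imports Defs
begin

text \<open>
  The power \<open>\<mm>^n\<close> consists of the series supported on the set \<open>S n\<close> of sums of at least \<open>n\<close>
  generators, so the monomials \<open>t^s\<close> with \<open>s \<in> S n - S (n + 1)\<close> form a basis of \<open>\<mm>^n / \<mm>^(n+1)\<close>.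
  Put \<open>a = 2h\<close> and \<open>b = a - 1\<close>. The sums of exactly \<open>n\<close> generators are the numbers
  \<open>n a b + i b + 2 a j\<close> with \<open>i, j \<le> n\<close>. If \<open>i \<ge> a\<close> or \<open>j \<ge> b\<close>, such a number is also a sum of more
  generators, since \<open>a\<close> steps of size \<open>b\<close> have the weight \<open>a b\<close>, and \<open>b\<close> steps of size \<open>2 a\<close> have
  the weight \<open>2 a b\<close>. Otherwise \<open>n\<close> is the maximal length and \<open>(i, j)\<close> is unique, because \<open>b\<close> is
  coprime to \<open>2 a\<close>. Hence the Hilbert function is \<open>(min n b + 1) (min n (b - 1) + 1)\<close>.
\<close>

section \<open>Sumsets and the filtration of the semigroup by length\<close>

primrec nsums :: "nat set \<Rightarrow> nat \<Rightarrow> nat set" where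
  "nsums A 0 = {0}"
| "nsums A (Suc n) = {s + a | s a. s \<in> nsums A n \<and> a \<in> A}"

definition nsums_ge :: "nat set \<Rightarrow> nat \<Rightarrow> nat set" where
  "nsums_ge A n = (\<Union>k\<in>{n..}. nsums A k)"

definition supported_on :: "nat set \<Rightarrow> 'k::zero fps set" where
  "supported_on S = {f. \<forall>n. fps_nth f n \<noteq> 0 \<longrightarrow> n \<in> S}"

lemma finite_nsums: "finite A \<Longrightarrow> finite (nsums A n)"
  by (induction n) (auto intro: finite_image_set2)

lemma nsums_add: "s \<in> nsums A n \<Longrightarrow> t \<in> nsums A m \<Longrightarrow> s + t \<in> nsums A (n + m)"
proof (induction m arbitrary: t)
  case (Suc m)
  then obtain t' a where t': "t' \<in> nsums A m" "a \<in> A" "t = t' + a"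
    by auto
  have "s + t' \<in> nsums A (n + m)"
    using Suc.IH Suc.prems(1) t'(1) by blast
  then have "(s + t') + a \<in> nsums A (Suc (n + m))"
    using t'(2) by auto
  then show ?case
    by (simp only: t'(3) add.assoc add_Suc_right)
qed simp

lemma numerical_semigroup_eq_nsums_ge: "numerical_semigroup A = nsums_ge A 0"
proof (intro equalityI subsetI)
  fix n assume "n \<in> numerical_semigroup A"
  then show "n \<in> nsums_ge A 0"
  proof induction
    case zero
    have "0 \<in> nsums A 0" by simp
    then show ?case unfolding nsums_ge_def by blast
  next
    case (add n a)
    then obtain k where "n \<in> nsums A k" by (auto simp: nsums_ge_def)
    with add have "n + a \<in> nsums A (Suc k)" by auto
    then show ?case unfolding nsums_ge_def by blast
  qed
next
  have "n \<in> numerical_semigroup A" if "n \<in> nsums A k" for n k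
    using that by (induction k arbitrary: n) (auto intro: numerical_semigroup.intros)
  then show "n \<in> numerical_semigroup A" if "n \<in> nsums_ge A 0" for n
    using that by (auto simp: nsums_ge_def)
qed

lemma nsums_ge_add: "s \<in> nsums_ge A n \<Longrightarrow> t \<in> nsums_ge A m \<Longrightarrow> s + t \<in> nsums_ge A (n + m)"
proof -
  assume "s \<in> nsums_ge A n" "t \<in> nsums_ge A m"
  then obtain k l where "n \<le> k" "s \<in> nsums A k" "m \<le> l" "t \<in> nsums A l"
    unfolding nsums_ge_def by blast
  then have "s + t \<in> nsums A (k + l)" "k + l \<in> {n + m..}"
    by (auto intro: nsums_add)
  then show ?thesis
    unfolding nsums_ge_def by blast
qed

lemma nsums_ge_antimono: "m \<le> n \<Longrightarrow> nsums_ge A n \<subseteq> nsums_ge A m"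
  unfolding nsums_ge_def by (intro UN_mono) auto

lemma nsums_ge_SucE:
  assumes "s \<in> nsums_ge A (Suc n)"
  obtains t a where "t \<in> nsums_ge A n" "a \<in> A" "s = t + a"
proof -
  obtain k where k: "k \<ge> Suc n" "s \<in> nsums A k"
    using assms by (auto simp: nsums_ge_def)
  then obtain k' where "k = Suc k'" by (cases k) auto
  with k that show thesis by (auto simp: nsums_ge_def)
qed

lemma nsums_subset_nsums_ge: "nsums A n \<subseteq> nsums_ge A n"
  by (auto simp: nsums_ge_def)

text \<open>With no representation of length above \<open>n\<close>, the given one of length at
  least \<open>n\<close> has length exactly \<open>n\<close>. For finite \<open>A\<close> this makes
  each layer of the filtration finite.\<close>

lemma nsums_ge_diff_subset: "nsums_ge A n - nsums_ge A (Suc n) \<subseteq> nsums A n"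
proof
  fix s assume s: "s \<in> nsums_ge A n - nsums_ge A (Suc n)"
  then obtain k where "n \<le> k" "s \<in> nsums A k"
    unfolding nsums_ge_def by blast
  moreover from this s have "\<not> Suc n \<le> k"
    unfolding nsums_ge_def by blast
  ultimately show "s \<in> nsums A n"
    by (simp add: le_antisym not_less_eq_eq)
qed

lemma nsums_ge_one:
  assumes "0 \<notin> A"
  shows "nsums_ge A 1 = nsums_ge A 0 - {0}"
proof -
  have "0 \<notin> nsums_ge A 1"
    using assms by (auto elim!: nsums_ge_SucE)
  moreover have "nsums_ge A 0 - nsums_ge A 1 \<subseteq> {0}"
    using nsums_ge_diff_subset[of A 0] by simp
  ultimately show ?thesis
    using nsums_ge_antimono[of 0 1 A] by blast
qed

section \<open>Power series with prescribed support\<close>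

lemma supported_on_mono: "S \<subseteq> T \<Longrightarrow> supported_on S \<subseteq> supported_on T"
  by (auto simp: supported_on_def)

lemma supported_on_add:
  fixes f g :: "'k::comm_monoid_add fps"
  assumes "f \<in> supported_on S" "g \<in> supported_on S"
  shows "f + g \<in> supported_on S"
  using assms by (force simp: supported_on_def)

lemma supported_on_mult:
  fixes f g :: "'k::comm_semiring_0 fps"
  assumes "f \<in> supported_on S" "g \<in> supported_on T"
    and "\<And>s t. s \<in> S \<Longrightarrow> t \<in> T \<Longrightarrow> s + t \<in> U"
  shows "f * g \<in> supported_on U"
proof -
  have "n \<in> U" if "fps_nth (f * g) n \<noteq> 0" for n
  proof -
    have "(\<Sum>i = 0..n. fps_nth f i * fps_nth g (n - i)) \<noteq> 0"
      using that by (simp add: fps_mult_nth)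
    then obtain i where "i \<in> {0..n}" "fps_nth f i * fps_nth g (n - i) \<noteq> 0"
      by (rule sum.not_neutral_contains_not_neutral)
    then have "i \<le> n" "fps_nth f i \<noteq> 0" "fps_nth g (n - i) \<noteq> 0"
      by auto
    then show ?thesis
      using assms(1,2) assms(3)[of i "n - i"] by (auto simp: supported_on_def)
  qed
  then show ?thesis by (auto simp: supported_on_def)
qed

lemma fps_X_power_supported_on:
  "s \<in> S \<Longrightarrow> (fps_X ^ s :: 'k::comm_semiring_1 fps) \<in> supported_on S"
  by (auto simp: supported_on_def fps_X_power_nth split: if_splits)

lemma fps_const_supported_on: "0 \<in> S \<Longrightarrow> fps_const c \<in> supported_on S"
  by (auto simp: supported_on_def split: if_splits)

text \<open>The recursion for the inverse expresses its coefficient at \<open>n\<close> through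
  products of a coefficient of \<open>f\<close> at \<open>i > 0\<close> and one of the inverse at
  \<open>n - i\<close>, so strong induction applies. It is what makes series with nonzero constant
  term units of \<open>R\<close>.\<close>

lemma inverse_supported_on:
  fixes f :: "'k::field fps"
  assumes f: "f \<in> supported_on S" "fps_nth f 0 \<noteq> 0"
    and S: "0 \<in> S" "\<And>s t. s \<in> S \<Longrightarrow> t \<in> S \<Longrightarrow> s + t \<in> S"
  shows "inverse f \<in> supported_on S"
proof -
  have "n \<in> S" if "fps_nth (inverse f) n \<noteq> 0" for n
    using that
  proof (induction n rule: less_induct)
    case (less n)
    show ?case
    proof (cases "n = 0")
      case False
      then have "fps_nth (inverse f) n =
          - inverse (fps_nth f 0) * (\<Sum>i = 1..n. fps_nth f i * fps_nth (inverse f) (n - i))"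
        by (cases n) (simp_all add: fps_inverse_def)
      with less.prems have "(\<Sum>i = 1..n. fps_nth f i * fps_nth (inverse f) (n - i)) \<noteq> 0"
        by auto
      then obtain i where "i \<in> {1..n}" "fps_nth f i * fps_nth (inverse f) (n - i) \<noteq> 0"
        by (rule sum.not_neutral_contains_not_neutral)
      then have i: "1 \<le> i" "i \<le> n" "fps_nth f i \<noteq> 0" "fps_nth (inverse f) (n - i) \<noteq> 0"
        by auto
      then have "i \<in> S" "n - i \<in> S"
        using f(1) less.IH[of "n - i"] by (auto simp: supported_on_def)
      with i S(2)[of i "n - i"] show ?thesis by simp
    qed (use S in simp)
  qed
  then show ?thesis by (auto simp: supported_on_def)
qed

text \<open>
  Every exponent of \<open>f\<close> is split as \<open>t + a\<close> with \<open>t \<in> S\<close> and \<open>a \<in> A\<close>; collecting the terms with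
  the same \<open>a\<close> writes \<open>f\<close> as a finite sum although its support may be infinite.
\<close>
lemma supported_on_decompose:
  fixes f :: "'k::comm_ring_1 fps"
  assumes f: "f \<in> supported_on T" and A: "finite A"
    and T: "\<And>s. s \<in> T \<Longrightarrow> \<exists>t\<in>S. \<exists>a\<in>A. s = t + a"
  obtains g where "\<And>a. a \<in> A \<Longrightarrow> g a \<in> supported_on S" "f = (\<Sum>a\<in>A. g a * fps_X ^ a)"
proof -
  obtain r where r: "\<And>s. s \<in> T \<Longrightarrow> r s \<in> A \<and> r s \<le> s \<and> s - r s \<in> S"
    using T by (metis add_diff_cancel_right' le_add2)
  define g where "g a = Abs_fps (\<lambda>n. if n + a \<in> T \<and> r (n + a) = a then fps_nth f (n + a) else 0)" for a
  have "g a \<in> supported_on S" for a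
    using r[of "_ + a"] by (fastforce simp: supported_on_def g_def split: if_splits)
  moreover have "f = (\<Sum>a\<in>A. g a * fps_X ^ a)"
  proof (rule fps_ext)
    fix n
    have eq: "fps_nth (g a * fps_X ^ a) n = (if n \<in> T \<and> a \<le> n \<and> r n = a then fps_nth f n else 0)" for a
      by (auto simp: fps_X_power_mult_right_nth g_def)
    show "fps_nth f n = fps_nth (\<Sum>a\<in>A. g a * fps_X ^ a) n"
    proof (cases "n \<in> T")
      case True
      have "(\<Sum>a\<in>A. fps_nth (g a * fps_X ^ a) n) = (\<Sum>a\<in>A. if a = r n then fps_nth f n else 0)"
        using r[OF True] True unfolding eq by (intro sum.cong) auto
      then show ?thesis
        using r[OF True] A by (simp add: fps_sum_nth)
    next
      case False
      then have "fps_nth f n = 0" using f by (auto simp: supported_on_def)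
      with False show ?thesis by (simp add: fps_sum_nth eq)
    qed
  qed
  ultimately show thesis by (rule that)
qed

section \<open>The maximal ideal, its powers and the graded components\<close>

locale semigroup_series_ring =
  fixes ms :: "nat list" and R :: "'k::field fps ring" (structure)
  assumes pos: "\<forall>m\<in>set ms. 0 < m"
    and R_def: "R = monomial_power_series_ring ms"
begin

abbreviation "\<Gamma> \<equiv> nsums_ge (set ms)"

lemma carrier_R: "carrier R = supported_on (\<Gamma> 0)"
  unfolding R_def monomial_power_series_ring_def
  using monomial_power_series_eq[OF pos, where 'k = 'k]
  by (simp add: supported_on_def numerical_semigroup_eq_nsums_ge)

lemma R_ops [simp]:
  "x \<otimes> y = x * y" "x \<oplus> y = x + y" "\<zero> = 0" "\<one> = 1"
  by (simp_all add: R_def monomial_power_series_ring_def ring_of_type_algebra_def)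

sublocale cring R
  unfolding R_def by (rule cring_monomial_power_series_ring[OF pos])

lemma R_uminus: "f \<in> carrier R \<Longrightarrow> \<ominus> f = - f"
  by (rule minus_equality) (auto simp: carrier_R supported_on_def)

lemma R_minus: "f \<in> carrier R \<Longrightarrow> g \<in> carrier R \<Longrightarrow> f \<ominus> g = f - g"
  by (simp add: a_minus_def R_uminus)

lemma zero_in_\<Gamma>: "0 \<in> \<Gamma> 0"
  using nsums_subset_nsums_ge[of "set ms" 0] by simp

lemma zero_notin_\<Gamma>: "0 \<notin> \<Gamma> (Suc n)"
  using pos by (auto elim!: nsums_ge_SucE)

lemma \<Gamma>_add_0: "s \<in> \<Gamma> n \<Longrightarrow> t \<in> \<Gamma> 0 \<Longrightarrow> t + s \<in> \<Gamma> n"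
  using nsums_ge_add[of t "set ms" 0 s n] by simp

lemma ideal_supported_on: "ideal (supported_on (\<Gamma> n)) R"
proof (rule idealI[OF ring_axioms])
  have sub: "supported_on (\<Gamma> n) \<subseteq> carrier R"
    unfolding carrier_R by (intro supported_on_mono nsums_ge_antimono) simp
  show "subgroup (supported_on (\<Gamma> n)) (add_monoid R)"
  proof (rule add.subgroupI[OF sub])
    show "supported_on (\<Gamma> n) \<noteq> {}"
      by (auto simp: supported_on_def intro: exI[of _ 0])
  qed (use sub in \<open>auto simp: supported_on_add R_uminus a_inv_def[symmetric], auto simp: supported_on_def R_uminus subset_iff\<close>)
  show "x \<otimes> f \<in> supported_on (\<Gamma> n)" if "f \<in> supported_on (\<Gamma> n)" "x \<in> carrier R" for f x
    using that by (auto simp: carrier_R intro: supported_on_mult \<Gamma>_add_0)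
  then show "f \<otimes> x \<in> supported_on (\<Gamma> n)" if "f \<in> supported_on (\<Gamma> n)" "x \<in> carrier R" for f x
    using that by (simp add: mult.commute)
qed

text \<open>A series of \<open>R\<close> with nonzero constant term is a unit, so a proper ideal
  contains none. The series without constant term form a proper ideal themselves, and maximality
  forces equality.\<close>

lemma maximalideal_eq:
  assumes "maximalideal \<mm> R"
  shows "\<mm> = supported_on (\<Gamma> 1)"
proof -
  interpret m: maximalideal \<mm> R by fact
  have "\<mm> \<subseteq> supported_on (\<Gamma> 1)"
  proof (rule ccontr)
    assume "\<not> \<mm> \<subseteq> supported_on (\<Gamma> 1)"
    then obtain f where f: "f \<in> \<mm>" "f \<notin> supported_on (\<Gamma> 1)" by blast
    then have fR: "f \<in> supported_on (\<Gamma> 0)"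
      using m.a_subset carrier_R by auto
    moreover have "\<Gamma> 1 = \<Gamma> 0 - {0}"
      using pos by (intro nsums_ge_one) auto
    ultimately have f0: "fps_nth f 0 \<noteq> 0"
      using f(2) by (auto simp: supported_on_def)
    have "inverse f \<in> carrier R"
      unfolding carrier_R using fR f0 zero_in_\<Gamma> \<Gamma>_add_0 by (intro inverse_supported_on) auto
    with f(1) have "inverse f \<otimes> f \<in> \<mm>"
      by (rule m.I_l_closed)
    with f0 have "\<one> \<in> \<mm>"
      by (simp add: inverse_mult_eq_1)
    with m.one_imp_carrier m.I_notcarr show False by simp
  qed
  moreover have "supported_on (\<Gamma> 1) \<noteq> carrier R"
  proof -
    have "\<one> \<notin> supported_on (\<Gamma> 1)"
      using zero_notin_\<Gamma>[of 0] by (auto simp: supported_on_def)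
    then show ?thesis using one_closed by metis
  qed
  ultimately show ?thesis
    using m.I_maximal[OF ideal_supported_on] ideal.Icarr[OF ideal_supported_on] by blast
qed

text \<open>Lengths add under multiplication, which gives one inclusion. For the other, one
  generator is split off each exponent; as there are finitely many generators, even a series of
  infinite support becomes a finite sum of products.\<close>

lemma ideal_power_eq: "supported_on (\<Gamma> 1) [^]\<^bsub>ideals_set R\<^esub> n = supported_on (\<Gamma> n)"
proof (induction n)
  case 0
  \<comment> \<open>The zeroth power is the unit for ideal multiplication, namely the whole ring, in
    agreement with \<open>\<Gamma> 0\<close>.\<close>
  then show ?case by (simp add: nat_pow_def ideals_set_def carrier_R)
next
  case (Suc n)
  have "supported_on (\<Gamma> n) \<cdot> supported_on (\<Gamma> 1) = supported_on (\<Gamma> (Suc n))"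
  proof (intro equalityI subsetI)
    fix f assume "f \<in> supported_on (\<Gamma> n) \<cdot> supported_on (\<Gamma> 1)"
    then show "f \<in> supported_on (\<Gamma> (Suc n))"
    proof induction
      case (prod f g)
      then show ?case
        using nsums_ge_add[of _ "set ms" n _ 1] by (auto intro: supported_on_mult)
    qed (simp add: supported_on_add)
  next
    interpret I: ideal "supported_on (\<Gamma> n) \<cdot> supported_on (\<Gamma> 1)" R
      by (intro ideal_prod_is_ideal ideal_supported_on)
    fix f :: "'k fps" assume f: "f \<in> supported_on (\<Gamma> (Suc n))"
    have "\<exists>t\<in>\<Gamma> n. \<exists>a\<in>set ms. s = t + a" if "s \<in> \<Gamma> (Suc n)" for s
      using that by (blast elim: nsums_ge_SucE)
    with f obtain g where g: "\<And>a. a \<in> set ms \<Longrightarrow> g a \<in> supported_on (\<Gamma> n)"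
      "f = (\<Sum>a\<in>set ms. g a * fps_X ^ a)"
      using supported_on_decompose[of f "\<Gamma> (Suc n)" "set ms" "\<Gamma> n"] by blast
    have X: "(fps_X ^ a :: 'k fps) \<in> supported_on (\<Gamma> 1)" if "a \<in> set ms" for a
      using that nsums_subset_nsums_ge[of "set ms" 1] by (intro fps_X_power_supported_on) auto
    have "(\<Sum>a\<in>B. g a * fps_X ^ a) \<in> supported_on (\<Gamma> n) \<cdot> supported_on (\<Gamma> 1)"
      if "finite B" "B \<subseteq> set ms" for B
      using that
    proof (induction B)
      case empty
      then show ?case using I.zero_closed by simp
    next
      case (insert a B)
      have "g a \<otimes> fps_X ^ a \<in> supported_on (\<Gamma> n) \<cdot> supported_on (\<Gamma> 1)"
        using insert.prems g(1) X by (intro ideal_prod.prod) auto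
      then show ?case
        using insert I.a_closed by simp
    qed
    then show "f \<in> supported_on (\<Gamma> n) \<cdot> supported_on (\<Gamma> 1)"
      unfolding g(2) by simp
  qed
  with Suc show ?case by (simp add: nat_pow_def ideals_set_def)
qed

lemma subfield_constants: "subfield (range fps_const) R"
proof -
  have sub: "range fps_const \<subseteq> carrier R"
    using zero_in_\<Gamma> by (auto simp: carrier_R fps_const_supported_on)
  show ?thesis
  proof (rule subfieldI)
    show "subcring (range fps_const) R"
    proof (rule subcringI'[OF subringI[OF sub]])
      show "\<one> \<in> range fps_const"
        by (metis R_ops(4) fps_const_1_eq_1 rangeI)
    qed (use sub in \<open>auto simp: R_uminus image_subset_iff\<close>)
    have "fps_const c \<in> Units (R\<lparr>carrier := range fps_const\<rparr>)" if "c \<noteq> 0" for c :: 'k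
      using that by (auto simp: Units_def intro!: exI[of _ "inverse c"])
    then show "Units (R\<lparr>carrier := range fps_const\<rparr>) = range fps_const - {\<zero>}"
      by (auto simp: Units_def)
  qed
qed

text \<open>Subtracting the term of \<open>f\<close> at \<open>s\<close> leaves a series supported
  on \<open>D\<close>. So one more exponent means one more line over the constants, the form in
  which \<open>dimension\<close> grows by one.\<close>

lemma line_extension_supported_on:
  assumes "s \<notin> D"
  shows "line_extension (range fps_const) (fps_X ^ s) (supported_on D) = supported_on (insert s D)"
proof (intro equalityI subsetI)
  fix f assume "f \<in> line_extension (range fps_const) (fps_X ^ s) (supported_on D)"
  then show "f \<in> supported_on (insert s D)"
    by (auto simp: line_extension_mem_iff supported_on_def fps_X_power_nth split: if_splits)
next
  fix f :: "'k fps" assume f: "f \<in> supported_on (insert s D)"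
  have "f - fps_const (fps_nth f s) * fps_X ^ s \<in> supported_on D"
    using f by (auto simp: supported_on_def fps_X_power_nth split: if_splits)
  then show "f \<in> line_extension (range fps_const) (fps_X ^ s) (supported_on D)"
    by (fastforce simp: line_extension_mem_iff
        intro: bexI[of _ "f - fps_const (fps_nth f s) * fps_X ^ s"])
qed

text \<open>The classes of the monomials \<open>t^s\<close> with \<open>s\<close> in the layer form
  a basis. The dimension is counted by adding these exponents one at a time to the empty
  support.\<close>

lemma graded_hilbert_function_eq_card:
  assumes "maximalideal \<mm> R"
  shows "graded_hilbert_function R (range fps_const) \<mm> n = card (\<Gamma> n - \<Gamma> (Suc n))"
proof -
  define J :: "'k fps set" where "J = supported_on (\<Gamma> (Suc n))"
  define K :: "'k fps set" where "K = range fps_const"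
  define h where "h f = J +> f" for f
  interpret J: ideal J R unfolding J_def by (rule ideal_supported_on)
  interpret h: ring_hom_ring R "R Quot J" h
    unfolding h_def using J.rcos_ring_hom_ring by simp
  have h_eq_iff: "h f = h g \<longleftrightarrow> f - g \<in> J" if "f \<in> carrier R" "g \<in> carrier R" for f g
    using quotient_eq_iff_same_a_r_cos[OF J.ideal_axioms that] that by (simp add: h_def R_minus)
  have K: "K \<subseteq> carrier R"
    unfolding K_def using subfieldE(3)[OF subfield_constants] .
  \<comment> \<open>The quotient must be nontrivial for the image of the constants to be a
    field.\<close>
  have "\<one>\<^bsub>R Quot J\<^esub> \<noteq> \<zero>\<^bsub>R Quot J\<^esub>"
  proof
    assume "\<one>\<^bsub>R Quot J\<^esub> = \<zero>\<^bsub>R Quot J\<^esub>"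
    then have "h 1 = h 0" using h.hom_one h.hom_zero by simp
    then have "1 \<in> J" using h_eq_iff[OF one_closed zero_closed] by simp
    then show False using zero_notin_\<Gamma>[of n] by (auto simp: J_def supported_on_def)
  qed
  then have field: "subfield (h ` K) (R Quot J)"
    unfolding K_def by (rule h.img_is_subfield(2)[OF subfield_constants])
  have sub: "supported_on D \<subseteq> carrier R" if "D \<subseteq> \<Gamma> n" for D
    unfolding carrier_R using that nsums_ge_antimono[of 0 n "set ms"] by (intro supported_on_mono) auto
  have dim: "h.S.dimension (card D) (h ` K) (h ` supported_on D)"
    if "finite D" "D \<subseteq> \<Gamma> n - \<Gamma> (Suc n)" for D
    using that
  proof (induction D)
    case empty
    have "supported_on {} = {0 :: 'k fps}"
      by (auto simp: supported_on_def fps_eq_iff)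
    then have "h ` supported_on {} = {\<zero>\<^bsub>R Quot J\<^esub>}"
      using h.hom_zero by simp
    then show ?case by simp
  next
    case (insert s D)
    have X: "fps_X ^ s \<in> carrier R"
      using insert.prems sub[of "{s}"] fps_X_power_supported_on[of s "{s}"] by auto
    have D: "supported_on D \<subseteq> carrier R"
      using insert.prems by (intro sub) auto
    \<comment> \<open>Independence: \<open>t^s - f\<close> has coefficient 1 at \<open>s\<close>, so
      it lies in \<open>J\<close> only if \<open>s\<close> is in
      \<open>\<Gamma> (Suc n)\<close>.\<close>
    have "h (fps_X ^ s) \<notin> h ` supported_on D"
    proof
      assume "h (fps_X ^ s) \<in> h ` supported_on D"
      then obtain f where f: "f \<in> supported_on D" "h (fps_X ^ s) = h f" by blast
      then have "fps_X ^ s - f \<in> J"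
        using h_eq_iff[OF X, of f] D by auto
      moreover have "fps_nth f s = 0"
        using f(1) insert.hyps(2) by (auto simp: supported_on_def)
      then have "fps_nth (fps_X ^ s - f) s \<noteq> 0"
        by (simp add: fps_X_power_nth)
      ultimately have "s \<in> \<Gamma> (Suc n)"
        unfolding J_def supported_on_def by blast
      with insert.prems show False by blast
    qed
    with h.S.dimension.Suc_dim[of "h (fps_X ^ s)" "h ` supported_on D" "card D" "h ` K"] insert X
    have "h.S.dimension (Suc (card D)) (h ` K)
        (h.S.line_extension (h ` K) (h (fps_X ^ s)) (h ` supported_on D))"
      by auto
    then show ?case
      unfolding h.line_extension_hom[OF K X D]
      using insert.hyps by (simp add: K_def line_extension_supported_on)
  qed
  \<comment> \<open>Spanning: deleting the terms with exponent in \<open>\<Gamma> (Suc n)\<close>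
    does not change the class modulo \<open>J\<close>.\<close>
  have "h ` supported_on (\<Gamma> n - \<Gamma> (Suc n)) = h ` supported_on (\<Gamma> n)"
  proof
    show "h ` supported_on (\<Gamma> n - \<Gamma> (Suc n)) \<subseteq> h ` supported_on (\<Gamma> n)"
      by (intro image_mono supported_on_mono) auto
    show "h ` supported_on (\<Gamma> n) \<subseteq> h ` supported_on (\<Gamma> n - \<Gamma> (Suc n))"
    proof
      fix x assume "x \<in> h ` supported_on (\<Gamma> n)"
      then obtain f where f: "f \<in> supported_on (\<Gamma> n)" "x = h f" by blast
      define g where "g = Abs_fps (\<lambda>k. if k \<in> \<Gamma> (Suc n) then 0 else fps_nth f k)"
      have g: "g \<in> supported_on (\<Gamma> n - \<Gamma> (Suc n))"
        using f(1) by (auto simp: supported_on_def g_def split: if_splits)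
      moreover have "f - g \<in> J"
        by (auto simp: J_def supported_on_def g_def split: if_splits)
      then have "h f = h g"
        using h_eq_iff[of f g] f(1) g sub[of "\<Gamma> n"] sub[of "\<Gamma> n - \<Gamma> (Suc n)"] by auto
      ultimately show "x \<in> h ` supported_on (\<Gamma> n - \<Gamma> (Suc n))"
        using f(2) by blast
    qed
  qed
  moreover have "finite (\<Gamma> n - \<Gamma> (Suc n))"
    using finite_subset[OF nsums_ge_diff_subset finite_nsums] by blast
  ultimately have "h.S.dimension (card (\<Gamma> n - \<Gamma> (Suc n))) (h ` K) (h ` supported_on (\<Gamma> n))"
    using dim[of "\<Gamma> n - \<Gamma> (Suc n)"] by simp
  then have "h.S.dim (h ` K) (h ` supported_on (\<Gamma> n)) = card (\<Gamma> n - \<Gamma> (Suc n))"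
    using h.S.dimI[OF field] by (simp add: over_def)
  then show ?thesis
    unfolding graded_hilbert_function_def graded_component_def maximalideal_eq[OF assms]
      ideal_power_eq J_def[symmetric] K_def[symmetric] h_def[symmetric] .
qed

end

section \<open>The semigroup with four generators\<close>

text \<open>
  As \<open>m0 + m3 = m1 + m2\<close>, a sum of
  \<open>n\<close> generators is determined by the numbers \<open>i\<close> of summands in \<open>{m1, m3}\<close> and \<open>j\<close> of summands
  in \<open>{m2, m3}\<close>, which may be any numbers up to \<open>n\<close>.
\<close>
locale segre_semigroup =
  fixes a b :: nat
  assumes a_eq: "a = Suc b" and odd_b: "odd b"
begin

text \<open>With \<open>a = 2h\<close> and \<open>b = 2h - 1\<close> one has
  \<open>m0 = a * b\<close>, \<open>m1 = m0 + b\<close>, \<open>m2 = m0 + 2 * a\<close> and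
  \<open>m3 = m0 + b + 2 * a\<close>. So each of the \<open>n\<close> summands contributes
  \<open>a * b\<close>, and the rest counts the two kinds of steps.\<close>

definition weight :: "nat \<Rightarrow> nat \<Rightarrow> nat \<Rightarrow> nat" where
  "weight n i j = n * (a * b) + i * b + j * (2 * a)"

definition gens :: "nat set" where
  "gens = {weight 1 0 0, weight 1 1 0, weight 1 0 1, weight 1 1 1}"

lemma weight_add: "weight n i j + weight n' i' j' = weight (n + n') (i + i') (j + j')"
  by (simp add: weight_def algebra_simps)

lemma nsums_gens: "nsums gens n = {weight n i j | i j. i \<le> n \<and> j \<le> n}"
proof (induction n)
  case 0
  then show ?case by (simp add: weight_def)
next
  case (Suc n)
  have gens: "gens = {weight 1 i j | i j. i \<le> 1 \<and> j \<le> 1}"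
    by (auto simp: gens_def le_Suc_eq)
  show ?case
  proof (intro equalityI subsetI)
    fix s assume "s \<in> nsums gens (Suc n)"
    then obtain t g where "s = t + g" "t \<in> nsums gens n" "g \<in> gens"
      by auto
    then obtain i j i' j' where "s = weight n i j + weight 1 i' j'" "i \<le> n" "j \<le> n" "i' \<le> 1" "j' \<le> 1"
      unfolding Suc.IH unfolding gens by blast
    then have "s = weight (Suc n) (i + i') (j + j')" "i + i' \<le> Suc n" "j + j' \<le> Suc n"
      by (simp_all add: weight_add)
    then show "s \<in> {weight (Suc n) i j | i j. i \<le> Suc n \<and> j \<le> Suc n}"
      by blast
  next
    fix s assume "s \<in> {weight (Suc n) i j | i j. i \<le> Suc n \<and> j \<le> Suc n}"
    then obtain i j where ij: "s = weight (Suc n) i j" "i \<le> Suc n" "j \<le> Suc n" by blast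
    \<comment> \<open>Subtraction is truncated: \<open>i'\<close> is 1 if \<open>i > 0\<close> and 0
      otherwise, and likewise \<open>j'\<close>. The last generator thus takes one step of each kind
      still available, leaving at most \<open>n\<close> of each.\<close>
    define i' j' where "i' = i - (i - 1)" and "j' = j - (j - 1)"
    have "s = weight n (i - 1) (j - 1) + weight 1 i' j'"
      unfolding weight_add ij by (simp add: i'_def j'_def)
    moreover have "weight n (i - 1) (j - 1) \<in> nsums gens n"
      using ij unfolding Suc.IH by force
    moreover have "weight 1 i' j' \<in> gens"
      unfolding gens i'_def j'_def by force
    ultimately show "s \<in> nsums gens (Suc n)"
      unfolding nsums.simps by blast
  qed
qed

text \<open>Modulo \<open>b\<close>, which is coprime to \<open>2 * a\<close>, the equation gives
  \<open>j' = j + b * t\<close>. Cancelling \<open>b\<close> leaves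
  \<open>n * a + i - n' * a - i' = 2 * a * t\<close>, and \<open>i < a\<close> decides both claims.
  Only \<open>i\<close> and \<open>j\<close> are bounded, so \<open>n\<close> is maximal among all
  representations.\<close>

lemma weight_eq_imp:
  assumes eq: "weight n i j = weight n' i' j'" and le: "i \<le> b" "j < b"
  shows "n' \<le> n" "n' = n \<Longrightarrow> i' = i \<and> j' = j"
proof -
  have "coprime b (2 * a)"
    using odd_b unfolding a_eq coprime_mult_right_iff by simp
  have "int b * (int n * a + i - int n' * a - i') = 2 * a * (int j' - j)"
    using arg_cong[OF eq, of int] by (simp add: weight_def algebra_simps)
  then have "int b dvd int (2 * a) * (int j' - j)"
    by (metis dvd_triv_left of_nat_mult of_nat_numeral)
  with \<open>coprime b (2 * a)\<close> have "int b dvd int j' - j"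
    by (metis coprime_dvd_mult_right_iff coprime_int_iff)
  then obtain t where t: "int j' - j = int b * t" by blast
  \<comment> \<open>A negative \<open>t\<close> would give
    \<open>j' \<le> j - b < 0\<close>.\<close>
  have "t \<ge> 0"
  proof (rule ccontr)
    assume "\<not> t \<ge> 0"
    then have "int b * t \<le> int b * (-1)" by (intro mult_left_mono) auto
    with t le show False by simp
  qed
  have b: "b > 0" using odd_b by presburger
  have "int b * (int n * a + i - int n' * a - i') = int b * (2 * a * t)"
    using arg_cong[OF eq, of int] t by (simp add: weight_def algebra_simps)
  then have p: "int n * a + i - int n' * a - i' = 2 * a * t"
    using b by simp
  have "\<not> n' > n"
  proof
    assume "n' > n"
    then have "int (Suc n) * a \<le> int n' * a" by (intro mult_right_mono) auto
    moreover have "0 \<le> 2 * int a * t" using \<open>t \<ge> 0\<close> by simp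
    ultimately show False using p le a_eq by (simp add: algebra_simps)
  qed
  then show "n' \<le> n" by simp
  assume "n' = n"
  have "t = 0"
  proof (rule ccontr)
    assume "t \<noteq> 0"
    then have "2 * int a * 1 \<le> 2 * int a * t" using \<open>t \<ge> 0\<close> by (intro mult_left_mono) auto
    then have "2 * int a \<le> int i - int i'"
      using p \<open>n' = n\<close> by simp
    with le a_eq show False by simp
  qed
  with p t \<open>n' = n\<close> show "i' = i \<and> j' = j" by simp
qed

lemma nsums_ge_gens_diff:
  "nsums_ge gens n - nsums_ge gens (Suc n) =
    (\<lambda>(i, j). weight n i j) ` ({..min n b} \<times> {..min n (b - 1)})"
proof (intro equalityI subsetI)
  fix s assume s: "s \<in> nsums_ge gens n - nsums_ge gens (Suc n)"
  then obtain i j where ij: "s = weight n i j" "i \<le> n" "j \<le> n"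
    using nsums_ge_diff_subset[of gens n] unfolding nsums_gens by blast
  have notin: "s \<noteq> weight k i' j'" if "k > n" "i' \<le> k" "j' \<le> k" for k i' j'
  proof -
    have "weight k i' j' \<in> nsums gens k"
      using that unfolding nsums_gens by blast
    then have "weight k i' j' \<in> nsums_ge gens (Suc n)"
      using that(1) unfolding nsums_ge_def by (auto simp: Suc_le_eq)
    with s show ?thesis by blast
  qed
  have "i \<le> b"
  proof (rule ccontr)
    assume "\<not> i \<le> b"
    then obtain i' where "i = a + i'" using a_eq less_eq_Suc_le nat_le_iff_add by (metis not_le)
    \<comment> \<open>\<open>a\<close> steps of size \<open>b\<close> are traded for one more
      summand \<open>a * b\<close>.\<close>
    then have "s = weight (Suc n) i' j"
      by (simp add: ij weight_def algebra_simps)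
    with notin[of "Suc n" i' j] ij \<open>i = a + i'\<close> show False by simp
  qed
  moreover have "j < b"
  proof (rule ccontr)
    assume "\<not> j < b"
    then obtain j' where "j = b + j'" using nat_le_iff_add by (metis not_less)
    \<comment> \<open>\<open>b\<close> steps of size \<open>2 * a\<close> are traded for two more
      summands \<open>a * b\<close>.\<close>
    then have "s = weight (Suc (Suc n)) i j'"
      by (simp add: ij weight_def algebra_simps)
    with notin[of "Suc (Suc n)" i j'] ij \<open>j = b + j'\<close> show False by simp
  qed
  ultimately show "s \<in> (\<lambda>(i, j). weight n i j) ` ({..min n b} \<times> {..min n (b - 1)})"
    using ij by auto
next
  fix s assume "s \<in> (\<lambda>(i, j). weight n i j) ` ({..min n b} \<times> {..min n (b - 1)})"
  moreover have "b > 0" using odd_b by presburger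
  ultimately obtain i j where ij: "s = weight n i j" "i \<le> n" "i \<le> b" "j \<le> n" "j < b"
    by auto
  have "s \<in> nsums gens n"
    unfolding nsums_gens using ij by blast
  moreover have "s \<notin> nsums_ge gens (Suc n)"
  proof
    assume "s \<in> nsums_ge gens (Suc n)"
    then obtain k i' j' where "k > n" "s = weight k i' j'"
      unfolding nsums_ge_def nsums_gens by (auto simp: Suc_le_eq)
    with weight_eq_imp(1)[of n i j k i' j'] ij show False by simp
  qed
  ultimately show "s \<in> nsums_ge gens n - nsums_ge gens (Suc n)"
    using nsums_subset_nsums_ge by blast
qed

lemma card_nsums_ge_gens_diff:
  "card (nsums_ge gens n - nsums_ge gens (Suc n)) = Suc (min n b) * Suc (min n (b - 1))"
proof -
  have "b > 0" using odd_b by presburger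
  have "inj_on (\<lambda>(i, j). weight n i j) ({..min n b} \<times> {..min n (b - 1)})"
  proof (rule inj_onI)
    fix p q
    assume "p \<in> {..min n b} \<times> {..min n (b - 1)}"
      and "(\<lambda>(i, j). weight n i j) p = (\<lambda>(i, j). weight n i j) q"
    with weight_eq_imp(2)[of n "fst p" "snd p" n "fst q" "snd q"] \<open>b > 0\<close> show "p = q"
      by (auto simp: case_prod_beta prod_eq_iff)
  qed
  then show ?thesis
    unfolding nsums_ge_gens_diff by (simp add: card_image card_cartesian_product)
qed

end

section \<open>The Hilbert series\<close>

text \<open>Multiplication by \<open>1 - fps_X\<close> takes first differences of the
  coefficients.\<close>

lemma fps_eq_divide_one_minus_X:
  fixes F N :: "'k::field fps"
  assumes "\<And>n. fps_nth N n = fps_nth F n - (if n = 0 then 0 else fps_nth F (n - 1))"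
  shows "F = N / (1 - fps_X)"
proof -
  have "N = F * (1 - fps_X)"
    by (rule fps_ext) (simp add: assms right_diff_distrib)
  moreover have "(1 - fps_X :: 'k fps) \<noteq> 0"
    by (metis fps_nonzero_nth fps_one_nth fps_sub_nth fps_X_nth diff_zero zero_neq_one)
  ultimately show ?thesis by simp
qed

text \<open>The sum in the numerator starts at \<open>k = 0\<close>: its constant term must be 1,
  the dimension of \<open>R / \<mm>\<close> over the constants.\<close>

theorem corollary3p8:
  fixes h m0 m1 m2 m3 :: nat
    and R :: "'k::field fps ring"
    and \<mm> :: "'k fps set"
  assumes "h \<ge> 2"
    and "m0 = 2 * h * (2 * h - 1)"
    and "m1 = (2 * h + 1) * (2 * h - 1)"
    and "m2 = 2 * h * (2 * h + 1)"
    and "m3 = 2 * h * (2 * h + 1) + (2 * h - 1)"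
    and "R = monomial_power_series_ring [m0, m1, m2, m3]"
    and "maximalideal \<mm> R"
  shows "graded_hilbert_series R (range fps_const) \<mm> =
    ((\<Sum>k = 0..2 * h - 2. of_nat (2 * k + 1) * fps_X ^ k)
      + of_nat (2 * h - 1) * fps_X ^ (2 * h - 1)) / (1 - fps_X)"
proof -
  define b where "b = 2 * h - 1"
  have b: "2 * h = Suc b" "odd b" "b \<ge> 3"
    using assms(1) by (auto simp: b_def)
  interpret S: segre_semigroup "2 * h" b
    using b by unfold_locales auto
  have m: "m0 = S.weight 1 0 0" "m1 = S.weight 1 1 0" "m2 = S.weight 1 0 1" "m3 = S.weight 1 1 1"
    unfolding assms(2-5) S.weight_def unfolding b(1) by (simp_all add: algebra_simps)
  interpret semigroup_series_ring "[m0, m1, m2, m3]" R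
    using assms(1,6) by unfold_locales (auto simp: assms(2-5))
  have gens: "set [m0, m1, m2, m3] = S.gens"
    by (simp add: m S.gens_def)
  have H: "graded_hilbert_function R (range fps_const) \<mm> n = Suc (min n b) * Suc (min n (b - 1))" for n
    unfolding graded_hilbert_function_eq_card[OF assms(7)] gens S.card_nsums_ge_gens_diff ..
  have N: "fps_nth ((\<Sum>k = 0..b - 1. of_nat (2 * k + 1) * fps_X ^ k) + of_nat b * fps_X ^ b) n =
      (if n < b then of_nat (2 * n + 1) else if n = b then of_nat b else (0::rat))" for n
  proof -
    have "fps_nth (of_nat c * fps_X ^ k) n = (if n = k then of_nat c else (0::rat))" for c k
      by (simp add: fps_of_nat[symmetric] fps_X_power_nth)
    then have "fps_nth ((\<Sum>k = 0..b - 1. of_nat (2 * k + 1) * fps_X ^ k) + of_nat b * fps_X ^ b) n =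
      (\<Sum>k = 0..b - 1. if n = k then of_nat (2 * k + 1) else 0) + (if n = b then of_nat b else (0::rat))"
      by (simp only: fps_add_nth fps_sum_nth)
    then show ?thesis using b by (auto simp: sum.delta)
  qed
  have G: "fps_nth (graded_hilbert_series R (range fps_const) \<mm>) n =
      of_nat (Suc (min n b) * Suc (min n (b - 1)))" for n
    by (simp only: graded_hilbert_series_def fps_nth_Abs_fps H)
  have "graded_hilbert_series R (range fps_const) \<mm> =
      ((\<Sum>k = 0..b - 1. of_nat (2 * k + 1) * fps_X ^ k) + of_nat b * fps_X ^ b) / (1 - fps_X)"
  proof (rule fps_eq_divide_one_minus_X, unfold N G)
    fix n
    \<comment> \<open>The Hilbert function is \<open>(n + 1)^2\<close> for \<open>n < b\<close> and
      \<open>(b + 1) * b\<close> from \<open>n = b\<close> on. Its differences are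
      \<open>2 * n + 1\<close> below \<open>b\<close>, then \<open>(b + 1) * b - b^2 = b\<close> at
      \<open>b\<close>, and 0 afterwards.\<close>
    consider "n = 0" | k where "n = Suc k" "n < b" | "n = b" | k where "n = Suc k" "b \<le> k"
      by (metis less_Suc_eq_le linorder_neqE_nat not0_implies_Suc)
    then show "(if n < b then of_nat (2 * n + 1) else if n = b then of_nat b else 0) =
      (of_nat (Suc (min n b) * Suc (min n (b - 1))) :: rat) -
      (if n = 0 then 0 else of_nat (Suc (min (n - 1) b) * Suc (min (n - 1) (b - 1))))"
      by cases (use b(3) in \<open>auto simp: min_def algebra_simps of_nat_diff\<close>)
  qed
  moreover have "2 * h - 2 = b - 1" "2 * h - 1 = b"
    using b by auto
  ultimately show ?thesis by simp
qed

end
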